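(* Let $N\ge 3$, let $\Omega\subset\mathbb{R}^N$ be open and let $u\in C^2(\Omega)$ be harmonic in $\Omega$. For every $x_0\in\Omega$, the function $$r\mapsto\frac{c_N}{r^2}\int_{B(0,r)}\frac{|\nabla u(x_0+\xi)|^2}{|\xi|_{\mathbb{R}^N}^{N-2}}\,d\xi$$ is monotone increasing in a right neighborhood of $0$.
   Context: $|\cdot|_{\mathbb{R}^N}$ is the Euclidean norm, $B(0,r)=\{\xi\in\mathbb{R}^N:|\xi|_{\mathbb{R}^N}<r\}$, and $c_N>0$ is the dimensional constant for which $c_N|x-y|_{\mathbb{R}^N}^{2-N}$ is the fundamental solution of the Laplacian, i.e. $-\Delta_x\big(c_N|x-y|_{\mathbb{R}^N}^{2-N}\big)=\delta_y$. "Monotone increasing" means nondecreasing, and a right neighborhood of $0$ is an interval $(0,\delta)$, $\delta>0$ (with $\delta$ small enough that $x_0+B(0,\delta)\subset\Omega$). *)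

theory Defs
  imports "HOL-Analysis.Analysis"
begin

definition partial_deriv :: "'a::euclidean_space \<Rightarrow> ('a \<Rightarrow> real) \<Rightarrow> 'a \<Rightarrow> real" where
  "partial_deriv b f x = frechet_derivative f (at x) b"

text \<open>The class C^k on a set that is meant to be open. Iterating the successor clause, all
  partial derivatives of order up to k exist and are continuous; continuity of those of order
  less than k follows from differentiability.\<close>

primrec C_k_on :: "nat \<Rightarrow> 'a::euclidean_space set \<Rightarrow> ('a \<Rightarrow> real) \<Rightarrow> bool" where
  "C_k_on 0 S f \<longleftrightarrow> continuous_on S f"
| "C_k_on (Suc k) S f \<longleftrightarrow>
     (\<forall>x\<in>S. f differentiable (at x)) \<and> (\<forall>b\<in>Basis. C_k_on k S (partial_deriv b f))"

definition gradient :: "('a::euclidean_space \<Rightarrow> real) \<Rightarrow> 'a \<Rightarrow> 'a" where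
  "gradient f x = (\<Sum>b\<in>Basis. partial_deriv b f x *\<^sub>R b)"

lemma GDERIV_gradient:
  assumes "f differentiable (at x)"
  shows "GDERIV f x :> gradient f x"
proof -
  have D: "(f has_derivative frechet_derivative f (at x)) (at x)"
    using assms frechet_derivative_works by blast
  then have lin: "linear (frechet_derivative f (at x))"
    by (rule has_derivative_linear)
  have "frechet_derivative f (at x) h = h \<bullet> gradient f x" for h
  proof -
    have "frechet_derivative f (at x) h
        = frechet_derivative f (at x) (\<Sum>b\<in>Basis. (h \<bullet> b) *\<^sub>R b)"
      by (simp add: euclidean_representation)
    also have "\<dots> = (\<Sum>b\<in>Basis. (h \<bullet> b) * frechet_derivative f (at x) b)"
      by (simp add: linear_sum[OF lin] linear_scale[OF lin])
    also have "\<dots> = h \<bullet> gradient f x"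
      by (simp add: gradient_def partial_deriv_def inner_sum_right mult.commute)
    finally show ?thesis .
  qed
  then have "frechet_derivative f (at x) = (\<lambda>h. h \<bullet> gradient f x)" by blast
  with D show ?thesis by (simp add: gderiv_def)
qed

definition laplacian :: "('a::euclidean_space \<Rightarrow> real) \<Rightarrow> 'a \<Rightarrow> real" where
  "laplacian f x = (\<Sum>b\<in>Basis. partial_deriv b (partial_deriv b f) x)"

definition harmonic_on :: "'a::euclidean_space set \<Rightarrow> ('a \<Rightarrow> real) \<Rightarrow> bool" where
  "harmonic_on S u \<longleftrightarrow> C_k_on 2 S u \<and> (\<forall>x\<in>S. laplacian u x = 0)"

definition test_function :: "('a::euclidean_space \<Rightarrow> real) \<Rightarrow> bool" where
  "test_function \<phi> \<longleftrightarrow> (\<forall>k. C_k_on k UNIV \<phi>) \<and> compact (closure {x. \<phi> x \<noteq> 0})"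

text \<open>The identity \<open>- \<Delta> E = \<delta>\<^sub>y\<close> in the sense of distributions, for a locally
  integrable function \<open>E\<close>.\<close>

definition neg_laplacian_is_dirac :: "('a::euclidean_space \<Rightarrow> real) \<Rightarrow> 'a \<Rightarrow> bool" where
  "neg_laplacian_is_dirac E y \<longleftrightarrow>
     (\<forall>K. compact K \<longrightarrow> set_integrable lborel K E) \<and>
     (\<forall>\<phi>. test_function \<phi> \<longrightarrow> (LINT x|lborel. E x * (- laplacian \<phi> x)) = \<phi> y)"

text \<open>The property that singles out the dimensional constant \<open>c\<^sub>N\<close>, where \<open>N\<close> is the
  dimension of the type argument. The value at \<open>x = y\<close>, which is 0 for \<open>N \<ge> 3\<close>, is
  irrelevant.\<close>

definition newtonian_constant :: "'a::euclidean_space itself \<Rightarrow> real \<Rightarrow> bool" where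
  "newtonian_constant _ c \<longleftrightarrow>
     c > 0 \<and>
     (\<forall>y::'a. neg_laplacian_is_dirac (\<lambda>x. c * norm (x - y) powi (2 - int DIM('a))) y)"

end

theory Submission
  imports Defs
begin

text \<open>
After the substitution \<open>\<xi> = r y\<close> the factor \<open>1 / r\<^sup>2\<close> cancels
(\<open>scaled_inverse_power_integral\<close>), and the function in question is \<open>c\<close> times
\<open>\<integral> \<bar>\<nabla>u(x\<^sub>0 + r y)\<bar>\<^sup>2 \<bar>y\<bar>\<^bsup>2-N\<^esup> dy\<close> over the unit ball. The weight is radially decreasing, hence a
superposition of indicators of balls about the origin. It is therefore enough that the plain means
of \<open>\<bar>\<nabla>u\<bar>\<^sup>2\<close> over balls about \<open>x\<^sub>0\<close> increase with the radius
(\<open>inverse_power_weighted_ball_mean_mono\<close>).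

Those means increase because \<open>\<bar>\<nabla>u\<bar>\<^sup>2\<close> is a sum of squares of harmonic functions, hence subharmonic.
For a subharmonic function \<open>h\<close> of class \<open>C\<^sup>2\<close> the derivative of the mean is, by the divergence theorem
against the weight \<open>(1 - \<bar>y\<bar>\<^sup>2) / 2\<close>, an integral of \<open>\<Delta>h\<close> with nonnegative weight
(\<open>ball_mean_mono_of_subharmonic\<close>). The partial derivatives of \<open>u\<close> are a priori only \<open>C\<^sup>1\<close>;
instead of proving that harmonic functions are smooth, the monotonicity is shown for the squares of
the difference quotients of \<open>u\<close>, which are \<open>C\<^sup>2\<close> and subharmonic, and passes to the limit
(\<open>ball_mean_sq_directional_derivative_mono\<close>).

Any \<open>\<delta>\<close> with \<open>ball x\<^sub>0 \<delta> \<subseteq> \<Omega>\<close> works. The factor \<open>c > 0\<close> preserves inequalities, and its defining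
property supplies the integrability of \<open>\<bar>y\<bar>\<^bsup>2-N\<^esup>\<close> near the origin.\<close>

section \<open>Differentiation under the integral\<close>

lemma has_real_derivative_integral_dominated:
  fixes F :: "real \<Rightarrow> 'b \<Rightarrow> real"
  assumes \<epsilon>: "0 < \<epsilon>"
    and int: "\<And>t. \<bar>t - a\<bar> < \<epsilon> \<Longrightarrow> integrable M (F t)"
    and B: "integrable M B"
    and lip: "\<And>t x. \<bar>t - a\<bar> < \<epsilon> \<Longrightarrow> \<bar>F t x - F a x\<bar> \<le> \<bar>t - a\<bar> * B x"
    and deriv: "AE x in M. ((\<lambda>t. F t x) has_real_derivative D x) (at a)"
    and D: "D \<in> borel_measurable M"
  shows "((\<lambda>t. LINT x|M. F t x) has_real_derivative (LINT x|M. D x)) (at a)"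
  unfolding has_field_derivative_iff LIMSEQ_SEQ_conv[symmetric]
proof (intro allI impI, elim conjE)
  fix S :: "nat \<Rightarrow> real"
  assume ne: "\<forall>n. S n \<noteq> a" and S: "S \<longlonglongrightarrow> a"
  obtain n0 where n0: "\<And>n. n \<ge> n0 \<Longrightarrow> \<bar>S n - a\<bar> < \<epsilon>"
    using LIMSEQ_D[OF S \<epsilon>] by auto
  \<comment> \<open>Dominated convergence asks for a bound at every index, so the first terms are dropped.\<close>
  let ?T = "\<lambda>n. S (n + n0)"
  have T: "?T \<longlonglongrightarrow> a" using S by (rule LIMSEQ_ignore_initial_segment)
  have Teps: "\<bar>?T n - a\<bar> < \<epsilon>" for n using n0 by simp
  let ?Q = "\<lambda>n x. (F (?T n) x - F a x) / (?T n - a)"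
  have intQ: "integrable M (?Q n)" for n
    using int[OF Teps] int[of a] \<epsilon> by auto
  have "(\<lambda>n. LINT x|M. ?Q n x) \<longlonglongrightarrow> (LINT x|M. D x)"
  proof (rule integral_dominated_convergence[where w = B])
    show "AE x in M. (\<lambda>n. ?Q n x) \<longlonglongrightarrow> D x"
      using deriv
    proof eventually_elim
      case (elim x)
      have "(\<lambda>t. (F t x - F a x) / (t - a)) \<midarrow>a\<rightarrow> D x"
        using elim by (simp add: has_field_derivative_iff)
      then have "(\<lambda>n. (F (S n) x - F a x) / (S n - a)) \<longlonglongrightarrow> D x"
        unfolding LIMSEQ_SEQ_conv[symmetric] using ne S by blast
      then show ?case by (rule LIMSEQ_ignore_initial_segment)
    qed
    show "AE x in M. norm (?Q n x) \<le> B x" for n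
    proof (rule AE_I2)
      fix x
      show "norm (?Q n x) \<le> B x"
        using lip[OF Teps[of n], of x] ne by (simp add: abs_divide field_simps)
    qed
  qed (use D B intQ in auto)
  moreover have "(LINT x|M. ?Q n x) = ((LINT x|M. F (?T n) x) - (LINT x|M. F a x)) / (?T n - a)" for n
    using int[OF Teps[of n]] int[of a] \<epsilon> by simp
  then have "(\<lambda>n. LINT x|M. ?Q n x) = (\<lambda>n. ((LINT x|M. F (?T n) x) - (LINT x|M. F a x)) / (?T n - a))"
    by (rule ext)
  ultimately have "(\<lambda>n. ((LINT x|M. F (?T n) x) - (LINT x|M. F a x)) / (?T n - a)) \<longlonglongrightarrow> (LINT x|M. D x)"
    by metis
  then show "(\<lambda>n. ((LINT x|M. F (S n) x) - (LINT x|M. F a x)) / (S n - a)) \<longlonglongrightarrow> (LINT x|M. D x)"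
    by (rule LIMSEQ_offset)
qed

lemma lborel_integral_translate:
  fixes f :: "'a::euclidean_space \<Rightarrow> real"
  assumes "f \<in> borel_measurable borel"
  shows "(LINT x|lborel. f (v + x)) = (LINT x|lborel. f x)"
    and "integrable lborel f \<Longrightarrow> integrable lborel (\<lambda>x. f (v + x))"
proof -
  have "(LINT x|lborel. f x) = (LINT x|distr lborel borel ((+) v). f x)"
    by (simp add: lborel_distr_plus)
  also have "\<dots> = (LINT x|lborel. f (v + x))"
    using assms by (subst integral_distr) auto
  finally show "(LINT x|lborel. f (v + x)) = (LINT x|lborel. f x)" by simp
  show "integrable lborel (\<lambda>x. f (v + x))" if "integrable lborel f"
    using that integrable_distr_eq[of "(+) v" lborel borel f] assms by (simp add: lborel_distr_plus)
qed

text \<open>Translation invariance makes \<open>\<integral> \<psi>(t e + x) dx\<close> independent of \<open>t\<close>, so its derivative at \<open>t = 0\<close>, taken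
under the integral, vanishes. This replaces the fundamental theorem of calculus along lines parallel
to \<open>e\<close>, so that the space need not be split as a product. Differentiability is asked for
only almost everywhere, because \<open>\<psi>\<close> will have a kink along a sphere.\<close>

lemma integral_directional_derivative_eq_0:
  fixes \<psi> :: "'a::euclidean_space \<Rightarrow> real"
  assumes int: "integrable lborel \<psi>"
    and B: "integrable lborel B"
    and lip: "\<And>t x. \<bar>t\<bar> < 1 \<Longrightarrow> \<bar>\<psi> (t *\<^sub>R e + x) - \<psi> x\<bar> \<le> \<bar>t\<bar> * B x"
    and deriv: "AE x in lborel. ((\<lambda>t. \<psi> (t *\<^sub>R e + x)) has_real_derivative D x) (at 0)"
    and D: "D \<in> borel_measurable borel"
  shows "(LINT x|lborel. D x) = 0"
proof -
  have m: "\<psi> \<in> borel_measurable borel" using int by auto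
  have "((\<lambda>t. LINT x|lborel. \<psi> (t *\<^sub>R e + x)) has_real_derivative (LINT x|lborel. D x)) (at 0)"
    by (rule has_real_derivative_integral_dominated[where \<epsilon> = 1 and B = B])
      (use lip deriv D B lborel_integral_translate(2)[OF m int] in auto)
  then have "((\<lambda>t. LINT x|lborel. \<psi> x) has_real_derivative (LINT x|lborel. D x)) (at 0)"
    by (simp add: lborel_integral_translate(1)[OF m])
  then show ?thesis using DERIV_unique DERIV_const by blast
qed

section \<open>Gradients, segments and balls\<close>

lemma GDERIV_bounded_imp_lipschitz:
  fixes f :: "'a::euclidean_space \<Rightarrow> real"
  assumes "convex S" and f: "\<And>x. x \<in> S \<Longrightarrow> GDERIV f x :> g x"
    and L: "\<And>x. x \<in> S \<Longrightarrow> norm (g x) \<le> L"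
    and "x \<in> S" "y \<in> S"
  shows "\<bar>f x - f y\<bar> \<le> L * norm (x - y)"
proof -
  have "norm (f x - f y) \<le> L * norm (x - y)"
  proof (rule differentiable_bound[where S = S and f' = "\<lambda>x h. h \<bullet> g x"])
    fix z assume z: "z \<in> S"
    show "(f has_derivative (\<lambda>h. h \<bullet> g z)) (at z within S)"
      using f[OF z] by (simp add: gderiv_def has_derivative_at_withinI)
    show "onorm (\<lambda>h. h \<bullet> g z) \<le> L"
    proof (rule onorm_bound)
      show "0 \<le> L" using L[OF z] norm_ge_zero order_trans by blast
      fix h
      have "norm (h \<bullet> g z) \<le> norm h * norm (g z)" by (simp add: Cauchy_Schwarz_ineq2)
      also have "\<dots> \<le> norm h * L" by (intro mult_left_mono L z) simp
      finally show "norm (h \<bullet> g z) \<le> L * norm h" by (simp add: mult.commute)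
    qed
  qed (use assms in auto)
  then show ?thesis by simp
qed

lemma GDERIV_imp_continuous_on:
  fixes f :: "'a::euclidean_space \<Rightarrow> real"
  assumes "\<And>x. x \<in> S \<Longrightarrow> GDERIV f x :> g x"
  shows "continuous_on S f"
  using assms by (auto simp: gderiv_def intro!: continuous_at_imp_continuous_on has_derivative_continuous)

lemma GDERIV_line:
  fixes f :: "'a::euclidean_space \<Rightarrow> real"
  assumes "GDERIV f (x + a *\<^sub>R e) :> g"
  shows "((\<lambda>t. f (x + t *\<^sub>R e)) has_real_derivative (e \<bullet> g)) (at a)"
proof -
  have 1: "((\<lambda>t. x + t *\<^sub>R e) has_derivative (\<lambda>t. t *\<^sub>R e)) (at a)"
    by (auto intro!: derivative_eq_intros)
  have "((\<lambda>t. f (x + t *\<^sub>R e)) has_derivative (\<lambda>t. (t *\<^sub>R e) \<bullet> g)) (at a)"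
    using has_derivative_compose[OF 1 assms[unfolded gderiv_def]] .
  then show ?thesis
    by (simp add: has_field_derivative_def mult_commute_abs)
qed

lemma set_integrable_ball:
  fixes f :: "'a::euclidean_space \<Rightarrow> real"
  assumes "continuous_on (cball a r) f"
  shows "set_integrable lborel (ball a r) f"
  by (rule set_integrable_subset[of _ "cball a r"])
    (use borel_integrable_compact[OF compact_cball assms] in \<open>auto simp: set_integrable_def\<close>)

lemma compact_imp_norm_bounded_on:
  fixes f :: "'a::euclidean_space \<Rightarrow> 'b::real_normed_vector"
  assumes "compact S" "continuous_on S f"
  obtains K where "K > 0" "\<And>x. x \<in> S \<Longrightarrow> norm (f x) \<le> K"
  using compact_imp_bounded[OF compact_continuous_image[OF assms(2,1)]]
  by (auto simp: bounded_pos)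

lemma GDERIV_affine:
  fixes f :: "'a::euclidean_space \<Rightarrow> real"
  assumes "GDERIV f (v + a *\<^sub>R x) :> g"
  shows "GDERIV (\<lambda>x. f (v + a *\<^sub>R x)) x :> a *\<^sub>R g"
proof -
  have 1: "((\<lambda>x. v + a *\<^sub>R x) has_derivative (\<lambda>h. a *\<^sub>R h)) (at x)"
    by (auto intro!: derivative_eq_intros)
  show ?thesis
    using has_derivative_compose[OF 1 assms[unfolded gderiv_def]] by (simp add: gderiv_def)
qed

lemma set_integral_sum:
  fixes f :: "'i \<Rightarrow> 'b \<Rightarrow> real"
  assumes "\<And>i. i \<in> I \<Longrightarrow> set_integrable M A (f i)"
  shows "(LINT x:A|M. (\<Sum>i\<in>I. f i x)) = (\<Sum>i\<in>I. LINT x:A|M. f i x)"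
  using assms unfolding set_lebesgue_integral_def set_integrable_def
  by (simp add: sum_distrib_left)

lemma add_scaleR_in_ball:
  fixes x\<^sub>0 y :: "'a::real_normed_vector"
  assumes "\<bar>t\<bar> * norm y < R"
  shows "x\<^sub>0 + t *\<^sub>R y \<in> ball x\<^sub>0 R"
  using assms by (simp add: dist_norm)

lemma continuous_on_rescaled_ball:
  fixes f :: "'a::real_normed_vector \<Rightarrow> 'b::topological_space"
  assumes "continuous_on (ball x\<^sub>0 R) f" "0 \<le> r" "r < R"
  shows "continuous_on (cball 0 1) (\<lambda>y. f (x\<^sub>0 + r *\<^sub>R y))"
proof (rule continuous_on_compose2[OF assms(1)])
  have "r * norm y < R" if "norm y \<le> 1" for y :: 'a
    using mult_left_mono[OF that assms(2)] assms(3) by simp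
  then show "(\<lambda>y. x\<^sub>0 + r *\<^sub>R y) ` cball 0 1 \<subseteq> ball x\<^sub>0 R"
    using assms(2) by (auto intro!: add_scaleR_in_ball[unfolded mem_ball] simp: dist_norm)
qed (auto intro!: continuous_intros)

section \<open>Integration by parts on the unit ball\<close>

text \<open>The weight \<open>(\<bar>x\<bar>\<^sup>2 - 1) / 2\<close> has gradient \<open>x\<close> and vanishes on the unit sphere. Hence its product with
\<open>k\<close>, extended by zero, is Lipschitz on the whole space, and the integral of its derivative in the
direction \<open>e\<close> is zero. No boundary term appears, so no surface measure is involved.\<close>

lemma ball_integration_by_parts:
  fixes k :: "'a::euclidean_space \<Rightarrow> real"
  assumes S: "1 < S" and e: "norm e = 1"
    and k: "\<And>x. x \<in> ball 0 S \<Longrightarrow> GDERIV k x :> q x"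
    and q: "continuous_on (ball 0 S) q"
  shows "(LINT x:ball 0 1|lborel. (x \<bullet> e) * k x)
       = (LINT x:ball 0 1|lborel. (1 - (norm x)\<^sup>2) / 2 * (q x \<bullet> e))"
proof -
  have sub: "cball 0 1 \<subseteq> ball (0::'a) S" using S by auto
  have k_cont: "continuous_on (ball 0 S) k" using GDERIV_imp_continuous_on k by blast
  let ?\<phi> = "\<lambda>x. ((norm x)\<^sup>2 - 1) / 2 * k x"
  let ?g = "\<lambda>x. k x *\<^sub>R x + (((norm x)\<^sup>2 - 1) / 2) *\<^sub>R q x"
  have W: "GDERIV (\<lambda>x::'a. ((norm x)\<^sup>2 - 1) / 2) x :> x" for x
    unfolding gderiv_def power2_norm_eq_inner
    by (auto intro!: derivative_eq_intros simp: inner_commute)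
  have \<phi>: "GDERIV ?\<phi> x :> ?g x" if "x \<in> ball 0 S" for x
    using GDERIV_mult[OF W k[OF that]] by (simp add: add.commute)
  have g_cont: "continuous_on (cball 0 1) ?g"
    by (auto intro!: continuous_intros continuous_on_subset[OF k_cont sub] continuous_on_subset[OF q sub])
  obtain L where L: "L > 0" "\<And>x. x \<in> cball 0 1 \<Longrightarrow> norm (?g x) \<le> L"
    using compact_imp_norm_bounded_on[OF compact_cball g_cont] by blast
  obtain K where K: "K > 0" "\<And>x. x \<in> cball 0 1 \<Longrightarrow> norm (k x) \<le> K"
    using compact_imp_norm_bounded_on[OF compact_cball continuous_on_subset[OF k_cont sub]] by blast
  define \<psi> where "\<psi> = (\<lambda>x. indicator (ball 0 1) x *\<^sub>R ?\<phi> x)"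
  define D where "D = (\<lambda>x. indicator (ball 0 1) x *\<^sub>R (e \<bullet> ?g x))"
  \<comment> \<open>Across the sphere the Lipschitz bound comes from \<open>1 - \<bar>x\<bar>\<^sup>2 \<le> 2 (1 - \<bar>x\<bar>) \<le> 2 \<bar>x - y\<bar>\<close>.\<close>
  have edge: "\<bar>\<psi> x - \<psi> y\<bar> \<le> K * norm (x - y)" if x: "norm x < 1" and y: "\<not> norm y < 1" for x y
  proof -
    have "\<bar>\<psi> x - \<psi> y\<bar> = (1 - (norm x)\<^sup>2) / 2 * \<bar>k x\<bar>"
      using x y power_le_one[of "norm x" 2] by (simp add: \<psi>_def abs_mult)
    also have "\<dots> \<le> (1 - norm x) * K"
    proof (rule mult_mono)
      have "1 - (norm x)\<^sup>2 = (1 - norm x) * (1 + norm x)" by (simp add: power2_eq_square algebra_simps)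
      also have "\<dots> \<le> (1 - norm x) * 2" using x by (intro mult_left_mono) auto
      finally show "(1 - (norm x)\<^sup>2) / 2 \<le> 1 - norm x" by simp
      show "\<bar>k x\<bar> \<le> K" using K(2)[of x] x by simp
    qed (use x in auto)
    also have "\<dots> \<le> norm (x - y) * K"
      using y norm_triangle_sub[of y x] K(1) by (intro mult_right_mono) (auto simp: norm_minus_commute)
    finally show ?thesis by (simp add: mult.commute)
  qed
  have lip: "\<bar>\<psi> x - \<psi> y\<bar> \<le> (K + L) * norm (x - y)" for x y
  proof -
    consider "norm x < 1" "norm y < 1" | "norm x < 1" "\<not> norm y < 1"
      | "\<not> norm x < 1" "norm y < 1" | "\<not> norm x < 1" "\<not> norm y < 1" by blast
    then show ?thesis
    proof cases
      case 1
      then have "\<bar>\<psi> x - \<psi> y\<bar> = \<bar>?\<phi> x - ?\<phi> y\<bar>" by (simp add: \<psi>_def)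
      also have "\<dots> \<le> L * norm (x - y)"
        by (rule GDERIV_bounded_imp_lipschitz[where S = "cball 0 1" and g = ?g])
          (use 1 L \<phi> sub in auto)
      also have "\<dots> \<le> (K + L) * norm (x - y)" using K by (intro mult_right_mono) auto
      finally show ?thesis .
    next
      case 2
      with edge[of x y] L(1) show ?thesis
        by (smt (verit) mult_right_mono norm_ge_zero)
    next
      case 3
      with edge[of y x] L(1) show ?thesis
        by (smt (verit) mult_right_mono norm_ge_zero norm_minus_commute)
    next
      case 4
      then show ?thesis using K L by (simp add: \<psi>_def)
    qed
  qed
  \<comment> \<open>A shift of length below 1 moves the support of \<open>\<psi>\<close> inside the ball of radius 2.\<close>
  let ?B = "\<lambda>x::'a. indicator (ball 0 2) x *\<^sub>R (K + L)"
  have "(LINT x|lborel. D x) = 0"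
  proof (rule integral_directional_derivative_eq_0[where \<psi> = \<psi> and B = ?B and e = e])
    show "integrable lborel \<psi>"
      using set_integrable_ball[of 0 1 ?\<phi>] GDERIV_imp_continuous_on[of "cball 0 1" ?\<phi> ?g] \<phi> sub
      unfolding \<psi>_def set_integrable_def by blast
    have "set_integrable lborel (ball 0 1) (\<lambda>x. e \<bullet> ?g x)"
      by (intro set_integrable_ball continuous_on_inner continuous_on_const g_cont)
    then show "D \<in> borel_measurable borel"
      unfolding D_def set_integrable_def by auto
    show "integrable lborel ?B"
      using set_integrable_ball[of 0 2 "\<lambda>_::'a. K + L"] unfolding set_integrable_def by auto
    show "\<bar>\<psi> (t *\<^sub>R e + x) - \<psi> x\<bar> \<le> \<bar>t\<bar> * ?B x" if t: "\<bar>t\<bar> < 1" for t x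
    proof (cases "norm x < 2")
      case True
      then show ?thesis using lip[of "t *\<^sub>R e + x" x] e by (simp add: mult.commute)
    next
      case False
      have "norm x \<le> norm (t *\<^sub>R e + x) + norm (t *\<^sub>R e)"
        by (metis add.commute add_diff_cancel norm_triangle_ineq4)
      then have "\<not> norm (t *\<^sub>R e + x) < 1" using False t e by auto
      with False show ?thesis by (simp add: \<psi>_def)
    qed
    have "sphere (0::'a) 1 \<in> null_sets lborel"
      using negligible_sphere[of "0::'a" 1]
      by (auto simp: null_sets_completion_iff negligible_iff_null_sets negligible_convex_frontier)
    then have "AE x in lborel. x \<notin> sphere (0::'a) 1" by (rule AE_not_in)
    then show "AE x in lborel. ((\<lambda>t. \<psi> (t *\<^sub>R e + x)) has_real_derivative D x) (at 0)"
    proof eventually_elim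
      case (elim x)
      have near: "((\<lambda>t. t *\<^sub>R e + x) \<longlongrightarrow> x) (nhds 0)" 
        using tendsto_at_iff_tendsto_nhds[of "\<lambda>t. t *\<^sub>R e + x" 0] by (auto intro!: tendsto_eq_intros)
      show ?case
      proof (cases "norm x < 1")
        case True
        have "\<forall>\<^sub>F t in nhds 0. t *\<^sub>R e + x \<in> ball 0 1"
          by (rule topological_tendstoD[OF near]) (use True in auto)
        then have ev: "\<forall>\<^sub>F t in nhds 0. \<psi> (t *\<^sub>R e + x) = ?\<phi> (x + t *\<^sub>R e)"
          by eventually_elim (simp add: \<psi>_def add.commute)
        have "((\<lambda>t. ?\<phi> (x + t *\<^sub>R e)) has_real_derivative (e \<bullet> ?g x)) (at 0)"
          by (rule GDERIV_line) (use \<phi>[of x] True S in auto)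
        then show ?thesis using True
          by (subst DERIV_cong_ev[OF refl ev refl]) (simp add: D_def)
      next
        case False
        have "\<forall>\<^sub>F t in nhds 0. t *\<^sub>R e + x \<in> - cball 0 1"
          by (rule topological_tendstoD[OF near]) (use False elim in auto)
        then have ev: "\<forall>\<^sub>F t in nhds 0. \<psi> (t *\<^sub>R e + x) = 0"
          by eventually_elim (simp add: \<psi>_def)
        then show ?thesis using False
          by (subst DERIV_cong_ev[OF refl ev refl]) (simp add: D_def)
      qed
    qed
  qed
  moreover have e_g: "e \<bullet> ?g x = (x \<bullet> e) * k x - (1 - (norm x)\<^sup>2) / 2 * (q x \<bullet> e)" for x
    unfolding inner_add_right inner_scaleR_right inner_commute[of e x] inner_commute[of e "q x"]
    by (simp add: field_simps)
  ultimately have z: "(LINT x:ball 0 1|lborel. (x \<bullet> e) * k x - (1 - (norm x)\<^sup>2) / 2 * (q x \<bullet> e)) = 0"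
    by (simp only: set_lebesgue_integral_def D_def e_g)
  have "set_integrable lborel (ball 0 1) (\<lambda>x. (x \<bullet> e) * k x)"
       "set_integrable lborel (ball 0 1) (\<lambda>x. (1 - (norm x)\<^sup>2) / 2 * (q x \<bullet> e))"
    by (auto intro!: set_integrable_ball continuous_intros continuous_on_subset[OF k_cont sub] continuous_on_subset[OF q sub])
  from set_integral_diff(2)[OF this] z show ?thesis by simp
qed


section \<open>Means of subharmonic functions and of squared derivatives\<close>

text \<open>Write \<open>k\<close> for the gradient of \<open>h\<close> and \<open>d b\<close> for that of its component \<open>k \<bullet> b\<close>, so that \<open>\<Sum>\<^sub>b d b x \<bullet> b\<close> is
the Laplacian. The derivative of the mean in \<open>r\<close> is \<open>\<integral> y \<bullet> k(x\<^sub>0 + r y) dy\<close>, and integration by parts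
turns it into \<open>r \<integral> (1 - \<bar>y\<bar>\<^sup>2) / 2 \<Delta>h(x\<^sub>0 + r y) dy\<close>, an integral of nonnegative functions.\<close>

lemma ball_mean_mono_of_subharmonic:
  fixes h :: "'a::euclidean_space \<Rightarrow> real"
  assumes h: "\<And>x. x \<in> ball x\<^sub>0 R \<Longrightarrow> GDERIV h x :> k x"
    and k: "\<And>b x. b \<in> Basis \<Longrightarrow> x \<in> ball x\<^sub>0 R \<Longrightarrow> GDERIV (\<lambda>x. k x \<bullet> b) x :> d b x"
    and d: "\<And>b. b \<in> Basis \<Longrightarrow> continuous_on (ball x\<^sub>0 R) (d b)"
    and sub: "\<And>x. x \<in> ball x\<^sub>0 R \<Longrightarrow> 0 \<le> (\<Sum>b\<in>Basis. d b x \<bullet> b)"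
  shows "mono_on {0<..<R} (\<lambda>r. LINT y:ball 0 1|lborel. h (x\<^sub>0 + r *\<^sub>R y))"
proof -
  let ?\<Phi> = "\<lambda>r. LINT y:ball 0 1|lborel. h (x\<^sub>0 + r *\<^sub>R y)"
  let ?D = "\<lambda>r. LINT y:ball 0 1|lborel. y \<bullet> k (x\<^sub>0 + r *\<^sub>R y)"
  have h_cont: "continuous_on (ball x\<^sub>0 R) h" using GDERIV_imp_continuous_on h by blast
  have kb_cont: "continuous_on (ball x\<^sub>0 R) (\<lambda>x. k x \<bullet> b)" if "b \<in> Basis" for b
    using GDERIV_imp_continuous_on k[OF that] by blast
  then have k_cont: "continuous_on (ball x\<^sub>0 R) k" by (simp add: continuous_on_componentwise[of _ k])
  have deriv: "(?\<Phi> has_real_derivative ?D r) (at r)" if r: "0 < r" "r < R" for r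
  proof -
    \<comment> \<open>A slightly larger closed ball, on which the gradient is bounded uniformly for radii near \<open>r\<close>.\<close>
    define \<rho> where "\<rho> = (r + R) / 2"
    have \<rho>: "r < \<rho>" "\<rho> < R" using r by (auto simp: \<rho>_def)
    have cb: "cball x\<^sub>0 \<rho> \<subseteq> ball x\<^sub>0 R" using \<rho> by auto
    obtain L where L: "L > 0" "\<And>x. x \<in> cball x\<^sub>0 \<rho> \<Longrightarrow> norm (k x) \<le> L"
      using compact_imp_norm_bounded_on[OF compact_cball continuous_on_subset[OF k_cont cb]] by blast
    define \<epsilon> where "\<epsilon> = min r (\<rho> - r)"
    have t: "0 \<le> t" "t < \<rho>" "t < R" if "\<bar>t - r\<bar> < \<epsilon>" for t
      using that \<rho> by (auto simp: \<epsilon>_def)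
    have inside: "x\<^sub>0 + t *\<^sub>R y \<in> cball x\<^sub>0 \<rho>" if "\<bar>t - r\<bar> < \<epsilon>" "norm y < 1" for t and y :: 'a
      using mult_mono[of t \<rho> "norm y" 1] t[OF that(1)] that(2) by (simp add: dist_norm)
    show ?thesis
      unfolding set_lebesgue_integral_def
    proof (rule has_real_derivative_integral_dominated[where \<epsilon> = \<epsilon> and B = "\<lambda>y. indicator (ball 0 1) y *\<^sub>R L"])
      show "0 < \<epsilon>" using r \<rho> by (simp add: \<epsilon>_def)
      show "integrable lborel (\<lambda>y. indicator (ball 0 1) y *\<^sub>R h (x\<^sub>0 + t *\<^sub>R y))" if "\<bar>t - r\<bar> < \<epsilon>" for t
        using set_integrable_ball[OF continuous_on_rescaled_ball[OF h_cont t(1,3)[OF that]]]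
        by (simp add: set_integrable_def)
      show "integrable lborel (\<lambda>y::'a. indicator (ball 0 1) y *\<^sub>R L)"
        using set_integrable_ball[of 0 1 "\<lambda>_::'a. L"] unfolding set_integrable_def by auto
      have "set_integrable lborel (ball 0 1) (\<lambda>y. y \<bullet> k (x\<^sub>0 + r *\<^sub>R y))"
        by (intro set_integrable_ball continuous_on_inner continuous_on_id continuous_on_rescaled_ball[OF k_cont])
          (use r in auto)
      then show "(\<lambda>y. indicator (ball 0 1) y *\<^sub>R (y \<bullet> k (x\<^sub>0 + r *\<^sub>R y))) \<in> borel_measurable lborel"
        unfolding set_integrable_def by (rule borel_measurable_integrable)
      show "\<bar>indicator (ball 0 1) y *\<^sub>R h (x\<^sub>0 + t *\<^sub>R y) - indicator (ball 0 1) y *\<^sub>R h (x\<^sub>0 + r *\<^sub>R y)\<bar>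
          \<le> \<bar>t - r\<bar> * (indicator (ball 0 1) y *\<^sub>R L)" if "\<bar>t - r\<bar> < \<epsilon>" for t and y :: 'a
      proof (cases "norm y < 1")
        case True
        have "\<bar>h (x\<^sub>0 + t *\<^sub>R y) - h (x\<^sub>0 + r *\<^sub>R y)\<bar> \<le> L * norm ((x\<^sub>0 + t *\<^sub>R y) - (x\<^sub>0 + r *\<^sub>R y))"
          by (rule GDERIV_bounded_imp_lipschitz[where S = "cball x\<^sub>0 \<rho>" and g = k])
            (use h cb L inside[OF that True] inside[of r y] True that in auto)
        also have "\<dots> = L * (\<bar>t - r\<bar> * norm y)" by (simp flip: scaleR_diff_left)
        also have "\<dots> \<le> L * (\<bar>t - r\<bar> * 1)" using L True by (intro mult_left_mono) auto
        finally show ?thesis using True by (simp add: mult.commute)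
      qed simp
      show "AE y in lborel. ((\<lambda>t. indicator (ball 0 1) y *\<^sub>R h (x\<^sub>0 + t *\<^sub>R y)) has_real_derivative
               indicator (ball 0 1) y *\<^sub>R (y \<bullet> k (x\<^sub>0 + r *\<^sub>R y))) (at r)"
      proof (rule AE_I2)
        fix y :: 'a
        show "((\<lambda>t. indicator (ball 0 1) y *\<^sub>R h (x\<^sub>0 + t *\<^sub>R y)) has_real_derivative
               indicator (ball 0 1) y *\<^sub>R (y \<bullet> k (x\<^sub>0 + r *\<^sub>R y))) (at r)"
        proof (cases "norm y < 1")
          case True
          have "GDERIV h (x\<^sub>0 + r *\<^sub>R y) :> k (x\<^sub>0 + r *\<^sub>R y)"
            using h cb inside[of r y] True r \<rho> by (auto simp: \<epsilon>_def)
          with True show ?thesis using GDERIV_line by simp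
        qed simp
      qed
    qed
  qed
  have nonneg: "0 \<le> ?D r" if r: "0 < r" "r < R" for r
  proof -
    have S: "1 < R / r" using r by simp
    have inside: "x\<^sub>0 + r *\<^sub>R y \<in> ball x\<^sub>0 R" if "norm y < R / r" for y :: 'a
      using that r by (intro add_scaleR_in_ball) (simp add: field_simps)
    have dc: "continuous_on (ball 0 (R / r)) (\<lambda>y. r *\<^sub>R d b (x\<^sub>0 + r *\<^sub>R y))" if "b \<in> Basis" for b
      by (intro continuous_intros continuous_on_compose2[OF d[OF that]]) (use inside in auto)
    have sub1: "cball (0::'a) 1 \<subseteq> ball 0 (R / r)" using S by auto
    have "?D r = (LINT y:ball 0 1|lborel. (\<Sum>b\<in>Basis. (y \<bullet> b) * (k (x\<^sub>0 + r *\<^sub>R y) \<bullet> b)))"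
      by (simp add: euclidean_inner[of _ "k _"])
    also have "\<dots> = (\<Sum>b\<in>Basis. LINT y:ball 0 1|lborel. (y \<bullet> b) * (k (x\<^sub>0 + r *\<^sub>R y) \<bullet> b))"
      by (intro set_integral_sum set_integrable_ball continuous_intros continuous_on_rescaled_ball[OF k_cont])
        (use r in auto)
    also have "\<dots> = (\<Sum>b\<in>Basis. LINT y:ball 0 1|lborel. (1 - (norm y)\<^sup>2) / 2 * ((r *\<^sub>R d b (x\<^sub>0 + r *\<^sub>R y)) \<bullet> b))"
    proof (rule sum.cong[OF refl])
      fix b :: 'a assume b: "b \<in> Basis"
      show "(LINT y:ball 0 1|lborel. (y \<bullet> b) * (k (x\<^sub>0 + r *\<^sub>R y) \<bullet> b))
          = (LINT y:ball 0 1|lborel. (1 - (norm y)\<^sup>2) / 2 * ((r *\<^sub>R d b (x\<^sub>0 + r *\<^sub>R y)) \<bullet> b))"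
        by (rule ball_integration_by_parts[OF S _ _ dc[OF b]])
          (use b inside k[OF b] GDERIV_affine[of "\<lambda>x. k x \<bullet> b"] in auto)
    qed
    also have "\<dots> = (LINT y:ball 0 1|lborel. (\<Sum>b\<in>Basis. (1 - (norm y)\<^sup>2) / 2 * ((r *\<^sub>R d b (x\<^sub>0 + r *\<^sub>R y)) \<bullet> b)))"
      by (intro set_integral_sum[symmetric] set_integrable_ball continuous_intros continuous_on_subset[OF dc sub1])
        auto
    also have "\<dots> = (LINT y:ball 0 1|lborel. (1 - (norm y)\<^sup>2) / 2 * (r * (\<Sum>b\<in>Basis. d b (x\<^sub>0 + r *\<^sub>R y) \<bullet> b)))"
      by (simp add: sum_distrib_left)
    also have "0 \<le> \<dots>"
      unfolding set_lebesgue_integral_def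
    proof (rule integral_nonneg_AE, rule AE_I2)
      fix y :: 'a
      show "0 \<le> indicator (ball 0 1) y *\<^sub>R
           ((1 - (norm y)\<^sup>2) / 2 * (r * (\<Sum>b\<in>Basis. d b (x\<^sub>0 + r *\<^sub>R y) \<bullet> b)))"
      proof (cases "norm y < 1")
        case True
        moreover have "(norm y)\<^sup>2 \<le> 1" using True by (simp add: power_le_one)
        moreover have "0 \<le> (\<Sum>b\<in>Basis. d b (x\<^sub>0 + r *\<^sub>R y) \<bullet> b)" using True S by (intro sub inside) simp
        ultimately show ?thesis using r by simp
      qed simp
    qed
    finally show ?thesis .
  qed
  show ?thesis
  proof (rule mono_onI)
    fix r s :: real assume rs: "r \<in> {0<..<R}" "s \<in> {0<..<R}" "r \<le> s"
    show "?\<Phi> r \<le> ?\<Phi> s"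
    proof (rule DERIV_nonneg_imp_nondecreasing[OF rs(3)])
      fix x assume "r \<le> x" "x \<le> s"
      then have "0 < x" "x < R" using rs by auto
      then show "\<exists>y. (?\<Phi> has_real_derivative y) (at x) \<and> 0 \<le> y" using deriv nonneg by blast
    qed
  qed
qed

text \<open>If \<open>u\<close> were known to have three derivatives, \<open>(e \<bullet> \<nabla>u)\<^sup>2\<close> would be subharmonic and the previous lemma
would apply to it. With two derivatives only, it is applied to the square of
\<open>w \<tau> x = u(x + \<tau> e) - u(x)\<close>: this is harmonic and as smooth as \<open>u\<close>, and \<open>\<Delta>(w\<^sup>2) = 2 \<bar>\<nabla>w\<bar>\<^sup>2\<close>. Dividing by
\<open>\<tau>\<^sup>2\<close> and letting \<open>\<tau>\<close> tend to zero keeps the inequality between the means.\<close>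

lemma ball_mean_sq_directional_derivative_mono:
  fixes u :: "'a::euclidean_space \<Rightarrow> real"
  assumes u: "\<And>x. x \<in> ball x\<^sub>0 R \<Longrightarrow> GDERIV u x :> p x"
    and p: "\<And>b x. b \<in> Basis \<Longrightarrow> x \<in> ball x\<^sub>0 R \<Longrightarrow> GDERIV (\<lambda>x. p x \<bullet> b) x :> q b x"
    and q: "\<And>b. b \<in> Basis \<Longrightarrow> continuous_on (ball x\<^sub>0 R) (q b)"
    and harm: "\<And>x. x \<in> ball x\<^sub>0 R \<Longrightarrow> (\<Sum>b\<in>Basis. q b x \<bullet> b) = 0"
    and e: "norm e = 1"
  shows "mono_on {0<..<R} (\<lambda>r. LINT y:ball 0 1|lborel. (e \<bullet> p (x\<^sub>0 + r *\<^sub>R y))\<^sup>2)"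
proof (rule mono_onI)
  fix r s :: real assume rs: "r \<in> {0<..<R}" "s \<in> {0<..<R}" "r \<le> s"
  have u_cont: "continuous_on (ball x\<^sub>0 R) u" using GDERIV_imp_continuous_on u by blast
  have pb_cont: "continuous_on (ball x\<^sub>0 R) (\<lambda>x. p x \<bullet> b)" if "b \<in> Basis" for b
    using GDERIV_imp_continuous_on p[OF that] by blast
  then have p_cont: "continuous_on (ball x\<^sub>0 R) p" by (simp add: continuous_on_componentwise[of _ p])
  \<comment> \<open>Points at distance at most \<open>s\<close> from \<open>x\<^sub>0\<close>, shifted by at most \<open>\<sigma> - s\<close>, stay within the closed ball of radius \<open>\<sigma> < R\<close>.\<close>
  define \<sigma> where "\<sigma> = (R + s) / 2"
  have \<sigma>: "s < \<sigma>" "\<sigma> < R" using rs by (auto simp: \<sigma>_def)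
  have cb: "cball x\<^sub>0 \<sigma> \<subseteq> ball x\<^sub>0 R" using \<sigma> by auto
  obtain L where L: "L > 0" "\<And>x. x \<in> cball x\<^sub>0 \<sigma> \<Longrightarrow> norm (p x) \<le> L"
    using compact_imp_norm_bounded_on[OF compact_cball continuous_on_subset[OF p_cont cb]] by blast
  define w where "w = (\<lambda>\<tau> x. u (\<tau> *\<^sub>R e + x) - u x)"
  define \<tau> where "\<tau> = (\<lambda>n. (\<sigma> - s) / real (Suc n))"
  have \<tau>_pos: "0 < \<tau> n" and \<tau>_le: "\<tau> n \<le> \<sigma> - s" for n
    using \<sigma> by (auto simp: \<tau>_def divide_le_eq mult_le_cancel_left1 intro: order_trans)
  have \<tau>_lim: "\<tau> \<longlonglongrightarrow> 0" unfolding \<tau>_def by (rule LIMSEQ_Suc[OF lim_const_over_n])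
  have shift: "a *\<^sub>R e + x \<in> ball x\<^sub>0 R" if "0 \<le> a" "x \<in> ball x\<^sub>0 (R - a)" for a x
  proof -
    have "dist x\<^sub>0 (a *\<^sub>R e + x) \<le> dist x\<^sub>0 x + dist x (a *\<^sub>R e + x)" by (rule dist_triangle)
    also have "dist x (a *\<^sub>R e + x) = a" using e that(1) by (simp add: dist_norm)
    finally show ?thesis using that by simp
  qed
  have step: "(LINT y:ball 0 1|lborel. (w a (x\<^sub>0 + r *\<^sub>R y))\<^sup>2) \<le> (LINT y:ball 0 1|lborel. (w a (x\<^sub>0 + s *\<^sub>R y))\<^sup>2)"
    if a: "0 < a" "a \<le> \<sigma> - s" for a
  proof -
    let ?pw = "\<lambda>x. p (a *\<^sub>R e + x) - p x"
    let ?qw = "\<lambda>b x. q b (a *\<^sub>R e + x) - q b x"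
    have s1: "a *\<^sub>R e + x \<in> ball x\<^sub>0 R" and s2: "x \<in> ball x\<^sub>0 R" if "x \<in> ball x\<^sub>0 (R - a)" for x
      using shift[OF _ that] that a by auto
    have w: "GDERIV (w a) x :> ?pw x" if "x \<in> ball x\<^sub>0 (R - a)" for x
      using GDERIV_diff[OF GDERIV_affine[of u _ 1] u[OF s2[OF that]]] u[OF s1[OF that]]
      by (simp add: w_def)
    have pw: "GDERIV (\<lambda>x. ?pw x \<bullet> b) x :> ?qw b x" if "x \<in> ball x\<^sub>0 (R - a)" "b \<in> Basis" for x b
      using GDERIV_diff[OF GDERIV_affine[of "\<lambda>x. p x \<bullet> b" _ 1] p[OF that(2) s2[OF that(1)]]]
        p[OF that(2) s1[OF that(1)]]
      by (simp add: inner_diff_left)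
    have "mono_on {0<..<R - a} (\<lambda>r. LINT y:ball 0 1|lborel. (\<lambda>x. (w a x)\<^sup>2) (x\<^sub>0 + r *\<^sub>R y))"
    proof (rule ball_mean_mono_of_subharmonic[where k = "\<lambda>x. (2 * w a x) *\<^sub>R ?pw x"
            and d = "\<lambda>b x. (2 * w a x) *\<^sub>R ?qw b x + (2 * (?pw x \<bullet> b)) *\<^sub>R ?pw x"])
      fix x assume x: "x \<in> ball x\<^sub>0 (R - a)"
      show "GDERIV (\<lambda>x. (w a x)\<^sup>2) x :> (2 * w a x) *\<^sub>R ?pw x"
        using GDERIV_mult[OF w[OF x] w[OF x]] by (simp add: power2_eq_square scaleR_2 flip: scaleR_scaleR)
      show "GDERIV (\<lambda>x. ((2 * w a x) *\<^sub>R ?pw x) \<bullet> b) x :> (2 * w a x) *\<^sub>R ?qw b x + (2 * (?pw x \<bullet> b)) *\<^sub>R ?pw x"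
        if b: "b \<in> Basis" for b
        using GDERIV_mult[OF GDERIV_mult[OF GDERIV_const[of 2] w[OF x]] pw[OF x b]]
        by (simp add: mult.commute)
      have "(\<Sum>b\<in>Basis. ((2 * w a x) *\<^sub>R ?qw b x + (2 * (?pw x \<bullet> b)) *\<^sub>R ?pw x) \<bullet> b)
          = 2 * w a x * ((\<Sum>b\<in>Basis. q b (a *\<^sub>R e + x) \<bullet> b) - (\<Sum>b\<in>Basis. q b x \<bullet> b))
            + 2 * (\<Sum>b\<in>Basis. (?pw x \<bullet> b)\<^sup>2)"
        by (simp add: inner_add_left inner_diff_left sum.distrib sum_subtractf sum_distrib_left power2_eq_square algebra_simps)
      also have "\<dots> \<ge> 0"
        unfolding harm[OF s1[OF x]] harm[OF s2[OF x]] by (simp add: sum_nonneg)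
      finally show "0 \<le> (\<Sum>b\<in>Basis. ((2 * w a x) *\<^sub>R ?qw b x + (2 * (?pw x \<bullet> b)) *\<^sub>R ?pw x) \<bullet> b)" .
    next
      fix b :: 'a assume b: "b \<in> Basis"
      have tr: "continuous_on (ball x\<^sub>0 (R - a)) (\<lambda>x. f (a *\<^sub>R e + x))" "continuous_on (ball x\<^sub>0 (R - a)) f"
        if f: "continuous_on (ball x\<^sub>0 R) f" for f :: "'a \<Rightarrow> 'a"
      proof -
        have "(\<lambda>x. a *\<^sub>R e + x) ` ball x\<^sub>0 (R - a) \<subseteq> ball x\<^sub>0 R" by (intro image_subsetI s1)
        then show "continuous_on (ball x\<^sub>0 (R - a)) (\<lambda>x. f (a *\<^sub>R e + x))"
          by (intro continuous_on_compose2[OF f, of _ "\<lambda>x. a *\<^sub>R e + x"] continuous_intros)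
        show "continuous_on (ball x\<^sub>0 (R - a)) f"
          by (rule continuous_on_subset[OF f]) (use a in auto)
      qed
      show "continuous_on (ball x\<^sub>0 (R - a)) (\<lambda>x. (2 * w a x) *\<^sub>R ?qw b x + (2 * (?pw x \<bullet> b)) *\<^sub>R ?pw x)"
        by (intro continuous_intros tr p_cont q[OF b] GDERIV_imp_continuous_on[OF w])
    qed
    then show ?thesis
      by (rule mono_onD) (use rs a \<sigma> in auto)
  qed
  have lim: "(\<lambda>n. LINT y:ball 0 1|lborel. (w (\<tau> n) (x\<^sub>0 + \<rho> *\<^sub>R y) / \<tau> n)\<^sup>2)
      \<longlonglongrightarrow> (LINT y:ball 0 1|lborel. (e \<bullet> p (x\<^sub>0 + \<rho> *\<^sub>R y))\<^sup>2)" if \<rho>: "0 < \<rho>" "\<rho> \<le> s" for \<rho>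
    unfolding set_lebesgue_integral_def
  proof (rule integral_dominated_convergence[where w = "\<lambda>y. indicator (ball 0 1) y *\<^sub>R L\<^sup>2"])
    have \<rho>R: "\<rho> < R" using \<rho> rs by auto
    have inside: "x\<^sub>0 + \<rho> *\<^sub>R y \<in> cball x\<^sub>0 s" if "norm y < 1" for y :: 'a
      using mult_mono[of \<rho> s "norm y" 1] that \<rho> by (simp add: dist_norm)
    have shifted: "\<tau> n *\<^sub>R e + x \<in> cball x\<^sub>0 \<sigma>" if "x \<in> cball x\<^sub>0 s" for n x
    proof -
      have "dist x\<^sub>0 (\<tau> n *\<^sub>R e + x) \<le> dist x\<^sub>0 x + dist x (\<tau> n *\<^sub>R e + x)" by (rule dist_triangle)
      also have "dist x (\<tau> n *\<^sub>R e + x) = \<tau> n" using e \<tau>_pos[of n] by (simp add: dist_norm)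
      finally show ?thesis using that \<tau>_le[of n] by simp
    qed
    have "set_integrable lborel (ball 0 1) (\<lambda>y. (e \<bullet> p (x\<^sub>0 + \<rho> *\<^sub>R y))\<^sup>2)"
      by (intro set_integrable_ball continuous_intros continuous_on_rescaled_ball[OF p_cont]) (use \<rho> \<rho>R in auto)
    then show "(\<lambda>y. indicator (ball 0 1) y *\<^sub>R (e \<bullet> p (x\<^sub>0 + \<rho> *\<^sub>R y))\<^sup>2) \<in> borel_measurable lborel"
      unfolding set_integrable_def by (rule borel_measurable_integrable)
    show "(\<lambda>y. indicator (ball 0 1) y *\<^sub>R (w (\<tau> n) (x\<^sub>0 + \<rho> *\<^sub>R y) / \<tau> n)\<^sup>2) \<in> borel_measurable lborel" for n
    proof -
      have "continuous_on (ball x\<^sub>0 (R - \<tau> n)) (w (\<tau> n))"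
      proof -
        have "(\<lambda>x. \<tau> n *\<^sub>R e + x) ` ball x\<^sub>0 (R - \<tau> n) \<subseteq> ball x\<^sub>0 R"
          using \<tau>_pos[of n] by (intro image_subsetI shift) auto
        then have "continuous_on (ball x\<^sub>0 (R - \<tau> n)) (\<lambda>x. u (\<tau> n *\<^sub>R e + x))"
          by (intro continuous_on_compose2[OF u_cont, of _ "\<lambda>x. \<tau> n *\<^sub>R e + x"] continuous_intros)
        moreover have "continuous_on (ball x\<^sub>0 (R - \<tau> n)) u"
          by (rule continuous_on_subset[OF u_cont]) (use \<tau>_pos[of n] in auto)
        ultimately show ?thesis unfolding w_def by (rule continuous_on_diff)
      qed
      then have "set_integrable lborel (ball 0 1) (\<lambda>y. (w (\<tau> n) (x\<^sub>0 + \<rho> *\<^sub>R y) / \<tau> n)\<^sup>2)"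
        using \<tau>_pos[of n] \<tau>_le[of n] \<sigma> \<rho>
        by (intro set_integrable_ball continuous_intros continuous_on_rescaled_ball[of _ "R - \<tau> n"]) auto
      then show ?thesis
        unfolding set_integrable_def by (rule borel_measurable_integrable)
    qed
    show "integrable lborel (\<lambda>y::'a. indicator (ball 0 1) y *\<^sub>R L\<^sup>2)"
      using set_integrable_ball[of 0 1 "\<lambda>_::'a. L\<^sup>2"] unfolding set_integrable_def by auto
    show "AE y in lborel. (\<lambda>n. indicator (ball 0 1) y *\<^sub>R (w (\<tau> n) (x\<^sub>0 + \<rho> *\<^sub>R y) / \<tau> n)\<^sup>2)
        \<longlonglongrightarrow> indicator (ball 0 1) y *\<^sub>R (e \<bullet> p (x\<^sub>0 + \<rho> *\<^sub>R y))\<^sup>2"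
    proof (rule AE_I2)
      fix y :: 'a
      show "(\<lambda>n. indicator (ball 0 1) y *\<^sub>R (w (\<tau> n) (x\<^sub>0 + \<rho> *\<^sub>R y) / \<tau> n)\<^sup>2)
        \<longlonglongrightarrow> indicator (ball 0 1) y *\<^sub>R (e \<bullet> p (x\<^sub>0 + \<rho> *\<^sub>R y))\<^sup>2"
      proof (cases "norm y < 1")
        case True
        let ?x = "x\<^sub>0 + \<rho> *\<^sub>R y"
        have "?x \<in> ball x\<^sub>0 R" using inside[OF True] \<sigma> by auto
        then have "((\<lambda>t. u (?x + t *\<^sub>R e)) has_real_derivative (e \<bullet> p ?x)) (at 0)"
          using u by (intro GDERIV_line) auto
        then have "(\<lambda>t. (u (?x + t *\<^sub>R e) - u ?x) / t) \<midarrow>0\<rightarrow> e \<bullet> p ?x"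
          by (simp add: has_field_derivative_iff)
        moreover have "\<forall>n. \<tau> n \<noteq> 0" using \<tau>_pos by (metis less_irrefl)
        ultimately have "(\<lambda>n. (u (?x + \<tau> n *\<^sub>R e) - u ?x) / \<tau> n) \<longlonglongrightarrow> e \<bullet> p ?x"
          unfolding LIMSEQ_SEQ_conv[symmetric] using \<tau>_lim by blast
        then have "(\<lambda>n. w (\<tau> n) ?x / \<tau> n) \<longlonglongrightarrow> e \<bullet> p ?x"
          by (simp add: w_def add.commute)
        then show ?thesis by (intro tendsto_intros)
      qed simp
    qed
    show "AE y in lborel. norm (indicator (ball 0 1) y *\<^sub>R (w (\<tau> n) (x\<^sub>0 + \<rho> *\<^sub>R y) / \<tau> n)\<^sup>2)
        \<le> indicator (ball 0 1) y *\<^sub>R L\<^sup>2" for n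
    proof (rule AE_I2)
      fix y :: 'a
      show "norm (indicator (ball 0 1) y *\<^sub>R (w (\<tau> n) (x\<^sub>0 + \<rho> *\<^sub>R y) / \<tau> n)\<^sup>2)
        \<le> indicator (ball 0 1) y *\<^sub>R L\<^sup>2"
      proof (cases "norm y < 1")
        case True
        let ?x = "x\<^sub>0 + \<rho> *\<^sub>R y"
        have "\<bar>w (\<tau> n) ?x\<bar> \<le> L * norm (\<tau> n *\<^sub>R e + ?x - ?x)"
          unfolding w_def
          by (rule GDERIV_bounded_imp_lipschitz[where S = "cball x\<^sub>0 \<sigma>" and g = p])
            (use u cb L inside[OF True] shifted[OF inside[OF True]] \<sigma> in auto)
        then have "\<bar>w (\<tau> n) ?x / \<tau> n\<bar> \<le> L"
          using e \<tau>_pos[of n] by (simp add: abs_divide divide_le_eq)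
        then have "(w (\<tau> n) ?x / \<tau> n)\<^sup>2 \<le> L\<^sup>2" by (metis abs_ge_zero power2_abs power_mono)
        then show ?thesis using True by simp
      qed simp
    qed
  qed
  show "(LINT y:ball 0 1|lborel. (e \<bullet> p (x\<^sub>0 + r *\<^sub>R y))\<^sup>2) \<le> (LINT y:ball 0 1|lborel. (e \<bullet> p (x\<^sub>0 + s *\<^sub>R y))\<^sup>2)"
  proof (rule LIMSEQ_le[OF lim lim])
    show "\<exists>N. \<forall>n\<ge>N. (LINT y:ball 0 1|lborel. (w (\<tau> n) (x\<^sub>0 + r *\<^sub>R y) / \<tau> n)\<^sup>2)
        \<le> (LINT y:ball 0 1|lborel. (w (\<tau> n) (x\<^sub>0 + s *\<^sub>R y) / \<tau> n)\<^sup>2)"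
      using step[OF \<tau>_pos \<tau>_le]
      by (auto simp: power_divide set_integral_divide_zero intro!: divide_right_mono)
  qed (use rs in auto)
qed

section \<open>From ball means to the singular weight\<close>

lemma nn_integral_scaleR:
  fixes f :: "'a::euclidean_space \<Rightarrow> ennreal"
  assumes [measurable]: "f \<in> borel_measurable borel" and r: "0 < r"
  shows "(\<integral>\<^sup>+x. f x \<partial>lborel) = ennreal (r ^ DIM('a)) * (\<integral>\<^sup>+x. f (r *\<^sub>R x) \<partial>lborel)"
proof -
  have "(\<integral>\<^sup>+x. f x \<partial>lborel)
      = (\<integral>\<^sup>+x. f x \<partial>density (distr lborel borel (\<lambda>x::'a. 0 + r *\<^sub>R x)) (\<lambda>_. \<bar>r\<bar> ^ DIM('a)))"
    using r by (subst lborel_affine[of r 0]) auto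
  also have "\<dots> = ennreal (r ^ DIM('a)) * (\<integral>\<^sup>+x. f (r *\<^sub>R x) \<partial>lborel)"
    using r by (simp add: nn_integral_density nn_integral_distr nn_integral_cmult)
  finally show ?thesis .
qed

lemma lborel_integral_scaleR:
  fixes f :: "'a::euclidean_space \<Rightarrow> real"
  assumes [measurable]: "f \<in> borel_measurable borel" and r: "0 < r"
  shows "(LINT x|lborel. f x) = r ^ DIM('a) * (LINT x|lborel. f (r *\<^sub>R x))"
proof -
  have "(LINT x|lborel. f x)
      = (LINT x|density (distr lborel borel (\<lambda>x::'a. 0 + r *\<^sub>R x)) (\<lambda>_. ennreal (\<bar>r\<bar> ^ DIM('a))). f x)"
    using r by (subst lborel_affine[of r 0]) (auto simp: ennreal_power)
  also have "\<dots> = r ^ DIM('a) * (LINT x|lborel. f (r *\<^sub>R x))"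
    using r by (subst integral_density) (auto simp: integral_distr)
  finally show ?thesis .
qed

lemma inverse_power_layer_cake:
  fixes s :: real
  assumes "0 < s"
  shows "ennreal (1 / s ^ m) = (\<integral>\<^sup>+t. indicator {t. 0 \<le> t \<and> t * s ^ m < 1} t \<partial>lborel)"
proof -
  have "{t. 0 \<le> t \<and> t * s ^ m < 1} = {0..<1 / s ^ m}"
    using assms by (auto simp: field_simps)
  then show ?thesis using assms by simp
qed

text \<open>The weight \<open>\<bar>y\<bar>\<^sup>-\<^sup>m\<close> on the unit ball is radially decreasing, so it is the integral over \<open>t\<close> of the
indicators of its superlevel sets, which are balls of radius \<open>\<rho> \<le> 1\<close> about the origin. For each of
them, \<open>\<integral> f(x\<^sub>0 + r y) dy\<close> over the ball of radius \<open>\<rho>\<close> is \<open>\<rho>\<^sup>N\<close> times the unit ball mean at \<open>r \<rho>\<close>, which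
is nondecreasing in \<open>r\<close>; Tonelli's theorem adds up the layers. Integrability of the weight
ensures that the comparison takes place between finite values.\<close>

lemma inverse_power_weighted_ball_mean_mono:
  fixes f :: "'a::euclidean_space \<Rightarrow> real"
  assumes f: "continuous_on (ball x\<^sub>0 R) f" and f_nonneg: "\<And>x. x \<in> ball x\<^sub>0 R \<Longrightarrow> 0 \<le> f x"
    and mean: "mono_on {0<..<R} (\<lambda>r. LINT y:ball 0 1|lborel. f (x\<^sub>0 + r *\<^sub>R y))"
    and m: "0 < m"
    and weight: "set_integrable lborel (ball (0::'a) 1) (\<lambda>y. 1 / norm y ^ m)"
  shows "mono_on {0<..<R} (\<lambda>r. LINT y:ball 0 1|lborel. f (x\<^sub>0 + r *\<^sub>R y) / norm y ^ m)"
proof -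
  define F where "F = (\<lambda>r y. indicator (ball (0::'a) 1) y *\<^sub>R f (x\<^sub>0 + r *\<^sub>R y))"
  have F_int: "integrable lborel (F r)" if "0 < r" "r < R" for r
    using set_integrable_ball[OF continuous_on_rescaled_ball[OF f, of r]] that
    by (simp add: F_def set_integrable_def)
  have F_meas: "F r \<in> borel_measurable borel" if "0 < r" "r < R" for r
    using F_int[OF that] by auto
  have inside: "x\<^sub>0 + r *\<^sub>R y \<in> ball x\<^sub>0 R" if "0 < r" "r < R" "norm y < 1" for r and y :: 'a
    using mult_strict_mono[of r R "norm y" 1] that by (intro add_scaleR_in_ball) auto
  have F_nonneg: "0 \<le> F r y" if "0 < r" "r < R" for r y
    using f_nonneg[OF inside[OF that]] by (cases "norm y < 1") (auto simp: F_def)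
  have unit: "(\<integral>\<^sup>+y. ennreal (F r y) \<partial>lborel) \<le> (\<integral>\<^sup>+y. ennreal (F s y) \<partial>lborel)"
    if rs: "0 < r" "r \<le> s" "s < R" for r s
  proof -
    have eq: "(\<integral>\<^sup>+y. ennreal (F a y) \<partial>lborel) = ennreal (LINT y:ball 0 1|lborel. f (x\<^sub>0 + a *\<^sub>R y))"
      if "0 < a" "a < R" for a
      using nn_integral_eq_integral[OF F_int[OF that]] F_nonneg[OF that]
      by (simp add: F_def set_lebesgue_integral_def)
    show ?thesis
      using mono_onD[OF mean, of r s] rs by (simp add: eq ennreal_leI)
  qed
  have smaller: "(\<integral>\<^sup>+y. ennreal (F r y) * indicator (ball 0 \<rho>) y \<partial>lborel)
      \<le> (\<integral>\<^sup>+y. ennreal (F s y) * indicator (ball 0 \<rho>) y \<partial>lborel)"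
    if rs: "0 < r" "r \<le> s" "s < R" and \<rho>: "0 < \<rho>" "\<rho> \<le> 1" for r s \<rho>
  proof -
    have eq: "(\<integral>\<^sup>+y. ennreal (F a y) * indicator (ball 0 \<rho>) y \<partial>lborel)
        = ennreal (\<rho> ^ DIM('a)) * (\<integral>\<^sup>+y. ennreal (F (a * \<rho>) y) \<partial>lborel)" if a: "0 < a" "a < R" for a
    proof -
      note [measurable] = F_meas[OF a]
      have "ennreal (F a (\<rho> *\<^sub>R y)) * indicator (ball 0 \<rho>) (\<rho> *\<^sub>R y) = ennreal (F (a * \<rho>) y)" for y
      proof (cases "norm y < 1")
        case True
        moreover have "\<rho> * norm y < 1"
          using mult_strict_mono[of \<rho> 1 "norm y" 1] True \<rho> mult_left_le_one_le[of "norm y" \<rho>] by auto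
        ultimately show ?thesis using \<rho> by (simp add: F_def)
      next
        case False
        then show ?thesis using \<rho> by (simp add: F_def)
      qed
      moreover have [measurable]: "ball (0::'a) \<rho> \<in> sets borel" by simp
      have "(\<lambda>y. ennreal (F a y) * indicator (ball 0 \<rho>) y) \<in> borel_measurable borel"
        by measurable
      ultimately show ?thesis by (subst nn_integral_scaleR[OF _ \<rho>(1)]) auto
    qed
    have "a * \<rho> < R" "0 < a * \<rho>" if a: "0 < a" "a < R" for a
    proof -
      have "a * \<rho> \<le> a" using a \<rho> by (intro mult_left_le) auto
      with a show "a * \<rho> < R" by linarith
      show "0 < a * \<rho>" using a \<rho> by simp
    qed
    then show ?thesis
      using rs \<rho> by (auto simp: eq intro!: mult_left_mono unit mult_right_mono)
  qed
  let ?W = "\<lambda>r. \<integral>\<^sup>+y. ennreal (F r y / norm y ^ m) \<partial>lborel"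
  have layers: "?W r = (\<integral>\<^sup>+t. \<integral>\<^sup>+y. ennreal (F r y) * indicator {(y, t). 0 \<le> t \<and> t * norm y ^ m < 1} (y, t)
      \<partial>lborel \<partial>lborel)" if r: "0 < r" "r < R" for r
  proof -
    note [measurable] = F_meas[OF r]
    \<comment> \<open>At the origin \<open>1 / 0 = 0\<close>, whereas every layer contains the origin; a null set is discarded.\<close>
    have "AE y in lborel. y \<noteq> (0::'a)" by (rule AE_lborel_singleton)
    then have "?W r = (\<integral>\<^sup>+y. \<integral>\<^sup>+t. ennreal (F r y) * indicator {(y, t). 0 \<le> t \<and> t * norm y ^ m < 1} (y, t)
      \<partial>lborel \<partial>lborel)"
    proof (intro nn_integral_cong_AE, eventually_elim)
      case (elim y)
      have "ennreal (F r y / norm y ^ m) = ennreal (F r y) * ennreal (1 / norm y ^ m)"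
        using F_nonneg[OF r, of y] by (simp flip: ennreal_mult)
      also have "\<dots> = ennreal (F r y) * (\<integral>\<^sup>+t. indicator {t. 0 \<le> t \<and> t * norm y ^ m < 1} t \<partial>lborel)"
        using elim by (subst inverse_power_layer_cake) auto
      also have "\<dots> = (\<integral>\<^sup>+t. ennreal (F r y) * indicator {t. 0 \<le> t \<and> t * norm y ^ m < 1} t \<partial>lborel)"
        by (rule nn_integral_cmult[symmetric]) measurable
      finally show ?case by (simp add: indicator_def)
    qed
    also have "\<dots> = (\<integral>\<^sup>+t. \<integral>\<^sup>+y. ennreal (F r y) * indicator {(y, t). 0 \<le> t \<and> t * norm y ^ m < 1} (y, t)
      \<partial>lborel \<partial>lborel)"
      by (rule lborel_pair.Fubini'[symmetric]) measurable
    finally show ?thesis .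
  qed
  have W_mono: "?W r \<le> ?W s" if rs: "0 < r" "r \<le> s" "s < R" for r s
  proof -
    have "?W r = (\<integral>\<^sup>+t. \<integral>\<^sup>+y. ennreal (F r y) * indicator {(y, t). 0 \<le> t \<and> t * norm y ^ m < 1} (y, t)
      \<partial>lborel \<partial>lborel)" using rs by (intro layers) auto
    also have "\<dots> \<le> (\<integral>\<^sup>+t. \<integral>\<^sup>+y. ennreal (F s y) * indicator {(y, t). 0 \<le> t \<and> t * norm y ^ m < 1} (y, t)
      \<partial>lborel \<partial>lborel)"
    proof (rule nn_integral_mono)
      fix t :: real
      show "(\<integral>\<^sup>+y. ennreal (F r y) * indicator {(y, t). 0 \<le> t \<and> t * norm y ^ m < 1} (y, t) \<partial>lborel)
         \<le> (\<integral>\<^sup>+y. ennreal (F s y) * indicator {(y, t). 0 \<le> t \<and> t * norm y ^ m < 1} (y, t) \<partial>lborel)"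
      proof (cases "0 < t")
        case True
        \<comment> \<open>The superlevel set at height \<open>t\<close>, cut off by the unit ball, is the ball of this radius.\<close>
        define \<rho> where "\<rho> = min 1 (root m (1 / t))"
        have \<rho>: "0 < \<rho>" "\<rho> \<le> 1" using True m by (auto simp: \<rho>_def)
        have level: "norm y < root m (1 / t) \<longleftrightarrow> t * norm y ^ m < 1" for y :: 'a
        proof -
          have "norm y < root m (1 / t) \<longleftrightarrow> root m (norm y ^ m) < root m (1 / t)"
            using m by (simp add: real_root_power_cancel)
          also have "\<dots> \<longleftrightarrow> norm y ^ m < 1 / t" using m by simp
          finally show ?thesis using True by (simp add: field_simps)
        qed
        have eq: "ennreal (F a y) * indicator {(y, t). 0 \<le> t \<and> t * norm y ^ m < 1} (y, t)
            = ennreal (F a y) * indicator (ball 0 \<rho>) y" for a y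
          using True by (auto simp: F_def \<rho>_def indicator_def level)
        show ?thesis unfolding eq by (rule smaller[OF rs \<rho>])
      next
        case False
        have eq: "ennreal (F a y) * indicator {(y, t). 0 \<le> t \<and> t * norm y ^ m < 1} (y, t)
            = ennreal (F a y) * indicator {0} t" for a y
          using False by (auto simp: indicator_def)
        show ?thesis
          unfolding eq using unit[OF rs] by (auto simp: indicator_def)
      qed
    qed
    also have "\<dots> = ?W s" using rs by (intro layers[symmetric]) auto
    finally show ?thesis .
  qed
  have W_finite: "?W r < \<infinity>" if r: "0 < r" "r < R" for r
  proof -
    obtain K where K: "K > 0" "\<And>y. y \<in> cball 0 1 \<Longrightarrow> norm (f (x\<^sub>0 + r *\<^sub>R y)) \<le> K"
      using compact_imp_norm_bounded_on[OF compact_cball continuous_on_rescaled_ball[OF f, of r]] r by auto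
    have "?W r \<le> (\<integral>\<^sup>+y. ennreal K * ennreal (indicator (ball (0::'a) 1) y *\<^sub>R (1 / norm y ^ m)) \<partial>lborel)"
    proof (rule nn_integral_mono)
      fix y :: 'a
      have "F r y / norm y ^ m \<le> K * (indicator (ball 0 1) y *\<^sub>R (1 / norm y ^ m))"
        using K(2)[of y] by (auto simp: F_def indicator_def intro!: divide_right_mono)
      then show "ennreal (F r y / norm y ^ m) \<le> ennreal K * ennreal (indicator (ball 0 1) y *\<^sub>R (1 / norm y ^ m))"
        using K(1) by (simp add: ennreal_leI flip: ennreal_mult)
    qed
    also have "\<dots> = ennreal K * (\<integral>\<^sup>+y. ennreal (indicator (ball (0::'a) 1) y *\<^sub>R (1 / norm y ^ m)) \<partial>lborel)"
      using borel_measurable_integrable[OF weight[unfolded set_integrable_def]]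
      by (intro nn_integral_cmult measurable_compose[OF _ measurable_ennreal])
    also have "\<dots> < \<infinity>"
      using integrableD(2)[OF weight[unfolded set_integrable_def]]
      by (simp add: ennreal_mult_less_top less_top)
    finally show ?thesis .
  qed
  have W_eq: "(LINT y:ball 0 1|lborel. f (x\<^sub>0 + r *\<^sub>R y) / norm y ^ m) = enn2real (?W r)"
    if r: "0 < r" "r < R" for r
  proof -
    note [measurable] = F_meas[OF r]
    have "(LINT y:ball 0 1|lborel. f (x\<^sub>0 + r *\<^sub>R y) / norm y ^ m) = (LINT y|lborel. F r y / norm y ^ m)"
      by (simp add: set_lebesgue_integral_def F_def)
    also have "\<dots> = enn2real (?W r)"
      by (rule integral_eq_nn_integral) (use F_nonneg[OF r] in auto)
    finally show ?thesis .
  qed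
  show ?thesis
  proof (rule mono_onI)
    fix r s :: real assume rs: "r \<in> {0<..<R}" "s \<in> {0<..<R}" "r \<le> s"
    then show "(LINT y:ball 0 1|lborel. f (x\<^sub>0 + r *\<^sub>R y) / norm y ^ m)
        \<le> (LINT y:ball 0 1|lborel. f (x\<^sub>0 + s *\<^sub>R y) / norm y ^ m)"
      using W_mono[of r s] W_finite[of s] by (simp add: W_eq enn2real_mono)
  qed
qed

text \<open>Local integrability of the fundamental solution is part of what it means for its negative
Laplacian to be a Dirac mass, so the integrability of \<open>\<bar>y\<bar>\<^bsup>2-N\<^esup>\<close> needs no computation.\<close>

lemma newtonian_constant_imp_weight_integrable:
  assumes "newtonian_constant TYPE('a::euclidean_space) c" and N: "DIM('a) \<ge> 3"
  shows "set_integrable lborel (ball (0::'a) 1) (\<lambda>y. 1 / norm y ^ (DIM('a) - 2))"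
proof -
  have c: "c > 0"
    and "neg_laplacian_is_dirac (\<lambda>x. c * norm (x - (0::'a)) powi (2 - int DIM('a))) (0::'a)"
    using assms unfolding newtonian_constant_def by blast+
  then have "set_integrable lborel (cball (0::'a) 1) (\<lambda>x. c * norm (x - 0) powi (2 - int DIM('a)))"
    unfolding neg_laplacian_is_dirac_def using compact_cball by blast
  then have "set_integrable lborel (ball (0::'a) 1) (\<lambda>x. (1 / c) * (c * norm (x - 0) powi (2 - int DIM('a))))"
    by (intro set_integrable_mult_right) (auto intro: set_integrable_subset)
  moreover have "(1 / c) * (c * norm (x - 0) powi (2 - int DIM('a))) = 1 / norm x ^ (DIM('a) - 2)" for x :: 'a
  proof -
    have eq: "2 - int DIM('a) = - int (DIM('a) - 2)" using N by simp
    show ?thesis unfolding eq using c by (simp add: power_int_minus inverse_eq_divide)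
  qed
  ultimately show ?thesis by simp
qed

text \<open>Under \<open>y \<mapsto> r y\<close> the volume contributes \<open>r\<^sup>N\<close> and the weight \<open>r\<^bsup>2-N\<^esup>\<close>; the prefactor \<open>1 / r\<^sup>2\<close> is exactly
what removes the explicit dependence on \<open>r\<close>.\<close>

lemma scaled_inverse_power_integral:
  fixes f :: "'a::euclidean_space \<Rightarrow> real"
  assumes f: "continuous_on (ball x\<^sub>0 R) f" and r: "0 < r" "r < R" and N: "DIM('a) \<ge> 2"
  shows "1 / r\<^sup>2 * (LINT y:ball 0 r|lborel. f (x\<^sub>0 + y) / norm y ^ (DIM('a) - 2))
       = (LINT y:ball 0 1|lborel. f (x\<^sub>0 + r *\<^sub>R y) / norm y ^ (DIM('a) - 2))"
proof -
  let ?m = "DIM('a) - 2"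
  have "continuous_on (ball 0 r) (\<lambda>y. f (x\<^sub>0 + y))"
    by (rule continuous_on_compose2[OF f]) (use r in \<open>auto intro!: continuous_intros simp: dist_norm\<close>)
  then have [measurable]: "(\<lambda>y. indicator (ball 0 r) y *\<^sub>R f (x\<^sub>0 + y)) \<in> borel_measurable borel"
    by (intro borel_measurable_continuous_on_indicator) auto
  have "(LINT y:ball 0 r|lborel. f (x\<^sub>0 + y) / norm y ^ ?m)
      = (LINT y|lborel. (indicator (ball 0 r) y *\<^sub>R f (x\<^sub>0 + y)) / norm y ^ ?m)"
    by (simp add: set_lebesgue_integral_def)
  also have "\<dots> = r ^ DIM('a) *
      (LINT y|lborel. (indicator (ball 0 r) (r *\<^sub>R y) *\<^sub>R f (x\<^sub>0 + r *\<^sub>R y)) / norm (r *\<^sub>R y) ^ ?m)"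
    by (rule lborel_integral_scaleR[OF _ r(1)]) measurable
  also have "(\<lambda>y::'a. (indicator (ball 0 r) (r *\<^sub>R y) *\<^sub>R f (x\<^sub>0 + r *\<^sub>R y)) / norm (r *\<^sub>R y) ^ ?m)
      = (\<lambda>y. (1 / r ^ ?m) * (indicator (ball 0 1) y *\<^sub>R (f (x\<^sub>0 + r *\<^sub>R y) / norm y ^ ?m)))"
    using r(1) by (auto simp: indicator_def power_mult_distrib)
  also have "r ^ DIM('a) * (LINT y|lborel. \<dots> y)
      = r ^ DIM('a) / r ^ ?m * (LINT y:ball 0 1|lborel. f (x\<^sub>0 + r *\<^sub>R y) / norm y ^ ?m)"
    unfolding set_lebesgue_integral_def integral_mult_right_zero by simp
  also have "r ^ DIM('a) / r ^ ?m = r\<^sup>2"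
  proof -
    have "DIM('a) = ?m + 2" using N by simp
    then have "r ^ DIM('a) = r ^ ?m * r\<^sup>2" by (metis power_add)
    then show ?thesis using r(1) by simp
  qed
  finally show ?thesis using r by simp
qed

section \<open>Monotonicity for the gradient of a harmonic function\<close>

lemma C_k_on_2D:
  assumes "C_k_on 2 S f"
  shows "x \<in> S \<Longrightarrow> GDERIV f x :> gradient f x"
    and "x \<in> S \<Longrightarrow> b \<in> Basis \<Longrightarrow> GDERIV (partial_deriv b f) x :> gradient (partial_deriv b f) x"
    and "b \<in> Basis \<Longrightarrow> continuous_on S (gradient (partial_deriv b f))"
proof -
  have *: "\<forall>x\<in>S. f differentiable at x" "\<forall>b\<in>Basis. \<forall>x\<in>S. partial_deriv b f differentiable at x"
    "\<forall>b\<in>Basis. \<forall>b'\<in>Basis. continuous_on S (partial_deriv b' (partial_deriv b f))"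
    using assms by (auto simp: numeral_2_eq_2)
  show "x \<in> S \<Longrightarrow> GDERIV f x :> gradient f x"
    using * by (blast intro: GDERIV_gradient)
  show "x \<in> S \<Longrightarrow> b \<in> Basis \<Longrightarrow> GDERIV (partial_deriv b f) x :> gradient (partial_deriv b f) x"
    using * by (blast intro: GDERIV_gradient)
  show "b \<in> Basis \<Longrightarrow> continuous_on S (gradient (partial_deriv b f))"
    unfolding gradient_def[abs_def] using * by (intro continuous_intros) auto
qed

lemma gradient_inner_Basis:
  "b \<in> Basis \<Longrightarrow> gradient f x \<bullet> b = partial_deriv b f x"
  by (simp add: gradient_def inner_sum_left inner_Basis if_distrib sum.delta cong: if_cong)

theorem corollary1p2:
  fixes \<Omega> :: "'a::euclidean_space set" and u :: "'a \<Rightarrow> real" and c :: real and x\<^sub>0 :: 'a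
  assumes "DIM('a) \<ge> 3"
    and "newtonian_constant TYPE('a) c"
    and "open \<Omega>"
    and "harmonic_on \<Omega> u"
    and "x\<^sub>0 \<in> \<Omega>"
  shows "\<exists>\<delta>>0. ball x\<^sub>0 \<delta> \<subseteq> \<Omega> \<and>
    mono_on {0<..<\<delta>} (\<lambda>r. c / r\<^sup>2 *
      (LINT \<xi>:ball 0 r|lborel. (norm (gradient u (x\<^sub>0 + \<xi>)))\<^sup>2 / norm \<xi> ^ (DIM('a) - 2)))"
proof -
  obtain \<delta> where \<delta>: "\<delta> > 0" "ball x\<^sub>0 \<delta> \<subseteq> \<Omega>"
    using assms(3,5) by (auto simp: open_contains_ball)
  have C2: "C_k_on 2 \<Omega> u" and harm: "\<And>x. x \<in> \<Omega> \<Longrightarrow> laplacian u x = 0"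
    using assms(4) by (auto simp: harmonic_on_def)
  let ?q = "\<lambda>b. gradient (partial_deriv b u)"
  let ?f = "\<lambda>x. (norm (gradient u x))\<^sup>2"
  have grad_b: "(\<lambda>x. gradient u x \<bullet> b) = partial_deriv b u" if "b \<in> Basis" for b
    using gradient_inner_Basis[OF that] by blast
  have pd_cont: "continuous_on (ball x\<^sub>0 \<delta>) (partial_deriv b u)" if "b \<in> Basis" for b
    using GDERIV_imp_continuous_on[of "ball x\<^sub>0 \<delta>" "partial_deriv b u"] C_k_on_2D(2)[OF C2 _ that] \<delta>(2) by blast
  have grad_cont: "continuous_on (ball x\<^sub>0 \<delta>) (gradient u)"
    using pd_cont by (simp add: continuous_on_componentwise[of _ "gradient u"] gradient_inner_Basis)
  have f_sum: "?f x = (\<Sum>b\<in>Basis. (b \<bullet> gradient u x)\<^sup>2)" for x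
    by (subst power2_norm_eq_inner, subst euclidean_inner) (simp add: inner_commute power2_eq_square)
  have one: "mono_on {0<..<\<delta>} (\<lambda>r. LINT y:ball 0 1|lborel. (b \<bullet> gradient u (x\<^sub>0 + r *\<^sub>R y))\<^sup>2)"
    if b: "b \<in> Basis" for b
  proof (rule ball_mean_sq_directional_derivative_mono[where q = ?q])
    fix x assume "x \<in> ball x\<^sub>0 \<delta>"
    then have x: "x \<in> \<Omega>" using \<delta> by blast
    show "GDERIV u x :> gradient u x" using C_k_on_2D(1)[OF C2 x] .
    show "GDERIV (\<lambda>x. gradient u x \<bullet> b) x :> ?q b x" if "b \<in> Basis" for b
      unfolding grad_b[OF that] using C_k_on_2D(2)[OF C2 x that] .
    show "(\<Sum>b\<in>Basis. ?q b x \<bullet> b) = 0"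
      using harm[OF x] by (simp add: laplacian_def gradient_inner_Basis)
  next
    show "continuous_on (ball x\<^sub>0 \<delta>) (?q b)" if "b \<in> Basis" for b
      using C_k_on_2D(3)[OF C2 that] \<delta>(2) by (rule continuous_on_subset)
  qed (use b in auto)
  have mean: "mono_on {0<..<\<delta>} (\<lambda>r. LINT y:ball 0 1|lborel. ?f (x\<^sub>0 + r *\<^sub>R y))"
  proof (rule mono_onI)
    have eq: "(LINT y:ball 0 1|lborel. ?f (x\<^sub>0 + r *\<^sub>R y))
        = (\<Sum>b\<in>Basis. LINT y:ball 0 1|lborel. (b \<bullet> gradient u (x\<^sub>0 + r *\<^sub>R y))\<^sup>2)"
      if "r \<in> {0<..<\<delta>}" for r
      unfolding f_sum
      by (intro set_integral_sum set_integrable_ball continuous_intros continuous_on_rescaled_ball[OF grad_cont])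
        (use that in auto)
    fix r s assume rs: "r \<in> {0<..<\<delta>}" "s \<in> {0<..<\<delta>}" "r \<le> s"
    show "(LINT y:ball 0 1|lborel. ?f (x\<^sub>0 + r *\<^sub>R y)) \<le> (LINT y:ball 0 1|lborel. ?f (x\<^sub>0 + s *\<^sub>R y))"
      unfolding eq[OF rs(1)] eq[OF rs(2)] by (intro sum_mono mono_onD[OF one] rs)
  qed
  have f_cont: "continuous_on (ball x\<^sub>0 \<delta>) ?f" by (intro continuous_intros grad_cont)
  have c: "c > 0" using assms(2) by (auto simp: newtonian_constant_def)
  have weighted: "mono_on {0<..<\<delta>} (\<lambda>r. LINT y:ball 0 1|lborel. ?f (x\<^sub>0 + r *\<^sub>R y) / norm y ^ (DIM('a) - 2))"
    by (rule inverse_power_weighted_ball_mean_mono[OF f_cont _ mean])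
      (use assms(1) newtonian_constant_imp_weight_integrable[OF assms(2,1)] in auto)
  have "mono_on {0<..<\<delta>} (\<lambda>r. c / r\<^sup>2 * (LINT \<xi>:ball 0 r|lborel. ?f (x\<^sub>0 + \<xi>) / norm \<xi> ^ (DIM('a) - 2)))"
  proof (rule mono_onI)
    have eq: "c / r\<^sup>2 * (LINT \<xi>:ball 0 r|lborel. ?f (x\<^sub>0 + \<xi>) / norm \<xi> ^ (DIM('a) - 2))
        = c * (LINT y:ball 0 1|lborel. ?f (x\<^sub>0 + r *\<^sub>R y) / norm y ^ (DIM('a) - 2))"
      if r: "r \<in> {0<..<\<delta>}" for r
    proof -
      have "c / r\<^sup>2 * I = c * (1 / r\<^sup>2 * I)" for I by simp
      also have "1 / r\<^sup>2 * (LINT \<xi>:ball 0 r|lborel. ?f (x\<^sub>0 + \<xi>) / norm \<xi> ^ (DIM('a) - 2))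
        = (LINT y:ball 0 1|lborel. ?f (x\<^sub>0 + r *\<^sub>R y) / norm y ^ (DIM('a) - 2))"
        by (rule scaled_inverse_power_integral[OF f_cont]) (use r assms(1) in auto)
      finally show ?thesis .
    qed
    fix r s assume rs: "r \<in> {0<..<\<delta>}" "s \<in> {0<..<\<delta>}" "r \<le> s"
    show "c / r\<^sup>2 * (LINT \<xi>:ball 0 r|lborel. ?f (x\<^sub>0 + \<xi>) / norm \<xi> ^ (DIM('a) - 2))
        \<le> c / s\<^sup>2 * (LINT \<xi>:ball 0 s|lborel. ?f (x\<^sub>0 + \<xi>) / norm \<xi> ^ (DIM('a) - 2))"
      unfolding eq[OF rs(1)] eq[OF rs(2)] using c by (intro mult_left_mono mono_onD[OF weighted] rs) auto
  qed
  with \<delta> show ?thesis by blast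
qed

end
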